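(* Let $X$ be a Banach space and $\mathcal I$ an ideal on $\mathbb N$. The operator $$S\colon c_{0,\mathcal I}(X)^*\longrightarrow \operatorname{ba}(\mathcal I,\ell_\infty(X)^* ),\qquad \varphi\longmapsto m_\varphi,$$ where $m_\varphi(A)\big((x_n)_n\big)=\varphi\big(\chi_A\cdot(x_n)_n\big)$ for all $A\in\mathcal I$ and $(x_n)_n\in\ell_\infty(X)$, is a (non-surjective) isometry.
   Context: An ideal on $\mathbb N$ is a collection of subsets of $\mathbb N$ containing $\emptyset$, closed under subsets and finite unions; every ideal is assumed to contain all finite sets. $\ell_\infty(X)$ is the Banach space of bounded sequences in $X$ with the sup norm, and $\ell_\infty(X)^*$ is its dual. $c_{0,\mathcal I}(X)$ is the closed subspace of $\ell_\infty(X)$ of all $(x_n)$ such that $\{n:\|x_n\|\ge\varepsilon\}\in\mathcal I$ for every $\varepsilon>0$, and $c_{0,\mathcal I}(X)^*$ is its dual. For $A\subseteq\mathbb N$ and $(x_n)_n\in\ell_\infty(X)$, $\chi_A\cdot(x_n)_n$ is the sequence whose $i$-th coordinate is $x_i$ if $i\in A$ and $0$ if $i\notin A$. For a normed space $E$, $\operatorname{ba}(\mathcal I,E)$ is the space of all maps $m\colon\mathcal I\to E$ with $m(A\cup B)=m(A)+m(B)$ for disjoint $A,B\in\mathcal I$ and $\|m\|<\infty$, equipped with the total variation norm $$\|m\|=\sup\Big\{\sum_{j=1}^n\|m(A_j)\| : n\in\mathbb N,\ A_1,\dots,A_n\in\mathcal I\text{ pairwise disjoint}\Big\}.$$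
   Formalization: Non-surjectivity is claimed only for X ≠ {0}, since for X = {0} both spaces are zero and S is onto; the isometry is proved for every X, with Banach spaces taken over the reals. *)

theory Defs
  imports "HOL-Analysis.Analysis"
begin

definition nat_ideal :: "nat set set \<Rightarrow> bool" where
  "nat_ideal \<I> \<longleftrightarrow>
     {} \<in> \<I> \<and>
     (\<forall>A B. A \<in> \<I> \<longrightarrow> B \<subseteq> A \<longrightarrow> B \<in> \<I>) \<and>
     (\<forall>A B. A \<in> \<I> \<longrightarrow> B \<in> \<I> \<longrightarrow> A \<union> B \<in> \<I>) \<and>
     (\<forall>A. finite A \<longrightarrow> A \<in> \<I>)"

text \<open>The space of bounded sequences in \<open>X\<close> with the sup norm is the type of bounded continuous
  functions on \<open>nat\<close>: the topology of \<open>nat\<close> is discrete, so continuity is no restriction.\<close>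

type_synonym 'a linf = "nat \<Rightarrow>\<^sub>C 'a"

definition chi_mult :: "nat set \<Rightarrow> 'a::real_normed_vector linf \<Rightarrow> 'a linf" where
  "chi_mult A x = Bcontfun (\<lambda>i. if i \<in> A then apply_bcontfun x i else 0)"

lemma apply_chi_mult: "apply_bcontfun (chi_mult A x) i = (if i \<in> A then apply_bcontfun x i else 0)"
proof -
  have "bounded (insert 0 (range (apply_bcontfun x)))"
    using apply_bcontfun[of x] by (simp add: bcontfun_def)
  then have "bounded (range (\<lambda>i. if i \<in> A then apply_bcontfun x i else 0))"
    by (rule bounded_subset) auto
  then have "(\<lambda>i. if i \<in> A then apply_bcontfun x i else 0) \<in> bcontfun"
    by (simp add: bcontfun_def)
  then show ?thesis
    by (simp add: chi_mult_def Bcontfun_inverse)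
qed

definition c0_ideal :: "nat set set \<Rightarrow> 'a::real_normed_vector linf set" where
  "c0_ideal \<I> = {x. \<forall>\<epsilon>>0. {n. norm (apply_bcontfun x n) \<ge> \<epsilon>} \<in> \<I>}"

text \<open>A subspace \<open>V\<close> that depends on a term has no type of its own. Its dual consists of the
  bounded linear functionals on \<open>V\<close>, each represented by its extension by \<open>0\<close> outside \<open>V\<close>
  (this extension is not linear on the whole type). Equality of functions is then equality on \<open>V\<close>,
  and the vector space operations are pointwise.\<close>

definition dual_on :: "'v::real_normed_vector set \<Rightarrow> ('v \<Rightarrow> real) set" where
  "dual_on V = {\<phi>.
     (\<forall>x\<in>V. \<forall>y\<in>V. \<phi> (x + y) = \<phi> x + \<phi> y) \<and>
     (\<forall>c. \<forall>x\<in>V. \<phi> (c *\<^sub>R x) = c * \<phi> x) \<and>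
     (\<exists>K. \<forall>x\<in>V. \<bar>\<phi> x\<bar> \<le> K * norm x) \<and>
     (\<forall>x. x \<notin> V \<longrightarrow> \<phi> x = 0)}"

definition dual_norm :: "'v::real_normed_vector set \<Rightarrow> ('v \<Rightarrow> real) \<Rightarrow> real" where
  "dual_norm V \<phi> = (SUP x\<in>{x \<in> V. norm x \<le> 1}. \<bar>\<phi> x\<bar>)"

definition total_variation :: "nat set set \<Rightarrow> (nat set \<Rightarrow> 'e::real_normed_vector) \<Rightarrow> ennreal" where
  "total_variation \<I> m =
     (SUP (n, A) \<in> {(n :: nat, A). (\<forall>j<n. A j \<in> \<I>) \<and> disjoint_family_on A {..<n}}.
        \<Sum>j<n. ennreal (norm (m (A j))))"

text \<open>As for \<^const>\<open>dual_on\<close>, maps with domain \<open>\<I>\<close> are extended by \<open>0\<close> outside \<open>\<I>\<close>.\<close>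

definition ba :: "nat set set \<Rightarrow> (nat set \<Rightarrow> 'e::real_normed_vector) set" where
  "ba \<I> = {m.
     (\<forall>A\<in>\<I>. \<forall>B\<in>\<I>. A \<inter> B = {} \<longrightarrow> m (A \<union> B) = m A + m B) \<and>
     total_variation \<I> m < \<infinity> \<and>
     (\<forall>A. A \<notin> \<I> \<longrightarrow> m A = 0)}"

definition ba_norm :: "nat set set \<Rightarrow> (nat set \<Rightarrow> 'e::real_normed_vector) \<Rightarrow> real" where
  "ba_norm \<I> m = enn2real (total_variation \<I> m)"

text \<open>\<^const>\<open>Blinfun\<close> is meaningful only on bounded linear maps. For \<open>\<phi>\<close> in the dual of
  \<^term>\<open>c0_ideal \<I>\<close> and \<open>A \<in> \<I>\<close> its argument here is one.\<close>

definition rep_measure ::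
  "nat set set \<Rightarrow> ('a::real_normed_vector linf \<Rightarrow> real) \<Rightarrow> nat set \<Rightarrow> ('a linf \<Rightarrow>\<^sub>L real)" where
  "rep_measure \<I> \<phi> A = (if A \<in> \<I> then Blinfun (\<lambda>x. \<phi> (chi_mult A x)) else 0)"

end

theory Submission
  imports Defs
begin

text \<open>For \<open>\<parallel>m\<^sub>\<phi>\<parallel> \<le> \<parallel>\<phi>\<parallel>\<close>, choose for disjoint \<open>A\<^sub>1, \<dots>, A\<^sub>n\<close> in the ideal elements \<open>x\<^sub>j\<close> of the
  unit ball that almost norm \<open>m\<^sub>\<phi>(A\<^sub>j)\<close>. The glued sequence \<open>\<Sum>\<^sub>j \<chi>\<^sub>A\<^sub>j x\<^sub>j\<close> has norm at most \<open>1\<close>, and \<open>\<phi>\<close> maps it to almost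
  \<open>\<Sum>\<^sub>j \<parallel>m\<^sub>\<phi>(A\<^sub>j)\<parallel>\<close>. For \<open>\<parallel>\<phi>\<parallel> \<le> \<parallel>m\<^sub>\<phi>\<parallel>\<close>, truncate \<open>x\<close> to the set \<open>A = {n. \<parallel>x\<^sub>n\<parallel> \<ge> \<epsilon>}\<close> of the ideal: the
  single value \<open>m\<^sub>\<phi>(A)\<close> already recovers \<open>\<phi>(x)\<close> up to \<open>\<epsilon> \<parallel>\<phi>\<parallel>\<close>.

  The operator is not onto since \<open>m\<^sub>\<phi>(A)\<close> depends only on the coordinates in \<open>A\<close>: the measure
  \<open>A \<mapsto> [0 \<in> A] G\<close> is not of this form when the functional \<open>G\<close> sees the coordinate \<open>1\<close>.
  Such a \<open>G\<close> comes from the Hahn-Banach theorem, proved here through minimal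
  sublinear functionals.\<close>

subsection \<open>Sublinear functionals and Hahn-Banach\<close>

text \<open>Homogeneity is asked only as an inequality for \<open>c > 0\<close>, which is easy to
  verify for infima. Using it for \<open>inverse c\<close> as well turns it into an
  equality.\<close>

definition sublinear :: "('v::real_vector \<Rightarrow> real) \<Rightarrow> bool" where
  "sublinear q \<longleftrightarrow> (\<forall>x y. q (x + y) \<le> q x + q y) \<and> (\<forall>c>0. \<forall>x. q (c *\<^sub>R x) \<le> c * q x)"

lemma sublinear_add: "sublinear q \<Longrightarrow> q (x + y) \<le> q x + q y"
  by (simp add: sublinear_def)

lemma sublinear_scale_le: "sublinear q \<Longrightarrow> c > 0 \<Longrightarrow> q (c *\<^sub>R x) \<le> c * q x"
  by (simp add: sublinear_def)

lemma sublinear_zero: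
  assumes "sublinear q"
  shows "q 0 = 0"
  \<comment> \<open>Subadditivity gives \<open>0 \<le> q 0\<close>, and scaling by one half gives
    \<open>q 0 \<le> q 0 / 2\<close>.\<close>
  using sublinear_add[OF assms, of 0 0] sublinear_scale_le[OF assms, of "1/2" 0] by simp

lemma sublinear_scale:
  assumes "sublinear q" "c \<ge> 0"
  shows "q (c *\<^sub>R x) = c * q x"
proof (cases "c = 0")
  case True
  then show ?thesis by (simp add: sublinear_zero[OF assms(1)])
next
  case False
  then have c: "c > 0" using assms by simp
  have "q x \<le> inverse c * q (c *\<^sub>R x)"
    using sublinear_scale_le[OF assms(1), of "inverse c" "c *\<^sub>R x"] c by simp
  then have "c * q x \<le> q (c *\<^sub>R x)"
    using c by (simp add: field_simps)
  then show ?thesis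
    using sublinear_scale_le[OF assms(1) c, of x] by simp
qed

lemma sublinear_minus_le:
  assumes "sublinear q"
  shows "- q (- x) \<le> q x"
  using sublinear_add[OF assms, of x "- x"] sublinear_zero[OF assms] by simp

text \<open>Common core of two constructions. In the additive condition \<open>k\<close> is the sum
  of two parameters for the tilt, and the smaller of two functionals for a chain.\<close>

lemma sublinear_INF:
  assumes ne: "I \<noteq> {}" and bdd: "\<And>x. bdd_below ((\<lambda>i. g i x) ` I)"
    and add: "\<And>i j x y. i \<in> I \<Longrightarrow> j \<in> I \<Longrightarrow> \<exists>k\<in>I. g k (x + y) \<le> g i x + g j y"
    and scale: "\<And>i c x. i \<in> I \<Longrightarrow> c > 0 \<Longrightarrow> \<exists>k\<in>I. g k (c *\<^sub>R x) \<le> c * g i x"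
  shows "sublinear (\<lambda>x. INF i\<in>I. g i x :: real)"
  unfolding sublinear_def
proof (intro conjI allI impI)
  fix x y
  have le: "(INF i\<in>I. g i (x + y)) \<le> g i x + g j y" if "i \<in> I" "j \<in> I" for i j
  proof -
    obtain k where "k \<in> I" "g k (x + y) \<le> g i x + g j y" using add[OF \<open>i \<in> I\<close> \<open>j \<in> I\<close>] by blast
    then show ?thesis using cINF_lower[OF bdd, of k "x + y"] by linarith
  qed
  \<comment> \<open>The two infima are taken one after the other: over \<open>i\<close> with
    \<open>j\<close> fixed, then over \<open>j\<close>.\<close>
  have "(INF i\<in>I. g i (x + y)) - g j y \<le> (INF i\<in>I. g i x)" if "j \<in> I" for j
    by (rule cINF_greatest[OF ne]) (use le[OF _ that] in \<open>simp add: algebra_simps\<close>)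
  then have "(INF i\<in>I. g i (x + y)) - (INF i\<in>I. g i x) \<le> (INF j\<in>I. g j y)"
    by (intro cINF_greatest[OF ne]) (simp add: algebra_simps)
  then show "(INF i\<in>I. g i (x + y)) \<le> (INF i\<in>I. g i x) + (INF i\<in>I. g i y)" by simp
next
  fix c :: real and x
  assume c: "c > 0"
  have "(INF i\<in>I. g i (c *\<^sub>R x)) / c \<le> (INF i\<in>I. g i x)"
  proof (rule cINF_greatest[OF ne])
    fix i assume "i \<in> I"
    then obtain k where "k \<in> I" "g k (c *\<^sub>R x) \<le> c * g i x" using scale[OF _ c] by blast
    then have "(INF i\<in>I. g i (c *\<^sub>R x)) \<le> c * g i x"
      using cINF_lower[OF bdd, of k "c *\<^sub>R x"] by linarith
    then show "(INF i\<in>I. g i (c *\<^sub>R x)) / c \<le> g i x"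
      using c by (simp add: field_simps)
  qed
  then show "(INF i\<in>I. g i (c *\<^sub>R x)) \<le> c * (INF i\<in>I. g i x)"
    using c by (simp add: field_simps)
qed

text \<open>The tilt lies below \<open>q\<close>, hence equals \<open>q\<close> if \<open>q\<close> is minimal. The term \<open>t = 1\<close> of the infimum then
  makes \<open>q\<close> superadditive. Tilting the norm along \<open>v\<close> forces \<open>f v \<ge> \<parallel>v\<parallel>\<close> for every linear \<open>f\<close> below it.\<close>

definition tilt :: "('v::real_vector \<Rightarrow> real) \<Rightarrow> 'v \<Rightarrow> 'v \<Rightarrow> real" where
  "tilt q y x = (INF t\<in>{0..}. q (x + t *\<^sub>R y) - t * q y)"

text \<open>Writing \<open>t *\<^sub>R y\<close> as the sum of \<open>- x\<close> and
  \<open>x + t *\<^sub>R y\<close> gives a lower bound that does not depend on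
  \<open>t\<close>.\<close>

lemma bdd_below_tilt:
  assumes "sublinear q"
  shows "bdd_below ((\<lambda>t. q (x + t *\<^sub>R y) - t * q y) ` {0..})"
proof (rule bdd_belowI2)
  fix t :: real assume "t \<in> {0..}"
  then show "- q (- x) \<le> q (x + t *\<^sub>R y) - t * q y"
    using sublinear_add[OF assms, of "- x" "x + t *\<^sub>R y"] sublinear_scale[OF assms, of t y] by simp
qed

lemma tilt_le:
  assumes "sublinear q" "t \<ge> 0"
  shows "tilt q y x \<le> q (x + t *\<^sub>R y) - t * q y"
  unfolding tilt_def by (rule cINF_lower[OF bdd_below_tilt[OF assms(1)]]) (use assms in simp)

lemma sublinear_tilt:
  assumes "sublinear q"
  shows "sublinear (tilt q y)"
  unfolding tilt_def[abs_def]
proof (rule sublinear_INF[OF _ bdd_below_tilt[OF assms]])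
  fix s t :: real and x z assume "s \<in> {0..}" "t \<in> {0..}"
  then show "\<exists>k\<in>{0..}. q (x + z + k *\<^sub>R y) - k * q y
      \<le> (q (x + s *\<^sub>R y) - s * q y) + (q (z + t *\<^sub>R y) - t * q y)"
    using sublinear_add[OF assms, of "x + s *\<^sub>R y" "z + t *\<^sub>R y"]
    by (intro bexI[of _ "s + t"]) (simp_all add: algebra_simps)
next
  fix t c :: real and x assume "t \<in> {0..}" "c > 0"
  then show "\<exists>k\<in>{0..}. q (c *\<^sub>R x + k *\<^sub>R y) - k * q y \<le> c * (q (x + t *\<^sub>R y) - t * q y)"
    using sublinear_scale_le[OF assms, of c "x + t *\<^sub>R y"]
    by (intro bexI[of _ "c * t"]) (simp_all add: algebra_simps)
qed simp

text \<open>By Zorn's lemma. The pointwise infimum over a nonempty chain is a genuine real infimum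
  because every sublinear \<open>q\<close> below \<open>p\<close> satisfies
  \<open>- p (- x) \<le> q x\<close>.\<close>

lemma ex_minimal_sublinear:
  assumes p: "sublinear p"
  obtains q where "sublinear q" "q \<le> p" "\<And>r. sublinear r \<Longrightarrow> r \<le> q \<Longrightarrow> r = q"
proof -
  define \<S> where "\<S> = {q. sublinear q \<and> q \<le> p}"
  have "\<exists>m\<in>\<S>. \<forall>a\<in>\<S>. a \<le> m \<longrightarrow> a = m"
  \<comment> \<open>The order is reversed, so a maximal element is a minimal functional and chains
    need lower bounds.\<close>
  proof (rule predicate_Zorn[where P = "\<lambda>a b. b \<le> a"])
    show "partial_order_on \<S> (relation_of (\<lambda>a b. b \<le> a) \<S>)"
      by (rule partial_order_on_relation_ofI) auto
  next
    fix C assume C: "C \<in> Chains (relation_of (\<lambda>a b. b \<le> a) \<S>)"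
    have CS: "sublinear q" "q \<le> p" if "q \<in> C" for q
      using C that by (auto simp: Chains_def relation_of_def \<S>_def)
    have tot: "a \<le> b \<or> b \<le> a" if "a \<in> C" "b \<in> C" for a b
      using C that by (auto simp: Chains_def relation_of_def)
    show "\<exists>u\<in>\<S>. \<forall>a\<in>C. u \<le> a"
    proof (cases "C = {}")
      case True
      then show ?thesis using p by (auto simp: \<S>_def)
    next
      case False
      define r where "r = (\<lambda>x. INF q\<in>C. q x)"
      have bdd: "bdd_below ((\<lambda>q. q x) ` C)" for x
      proof (rule bdd_belowI2)
        fix q assume q: "q \<in> C"
        show "- p (- x) \<le> q x"
          using sublinear_minus_le[OF CS(1)[OF q], of x] le_funD[OF CS(2)[OF q], of "- x"] by simp
      qed
      have "sublinear r"
        unfolding r_def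
      proof (rule sublinear_INF[OF False bdd])
        fix i j x y assume ij: "i \<in> C" "j \<in> C"
        then obtain k where k: "k \<in> C" "k \<le> i" "k \<le> j" using tot by blast
        then have "k (x + y) \<le> i x + j y"
          using sublinear_add[OF CS(1)[OF k(1)], of x y] le_funD[OF k(2), of x] le_funD[OF k(3), of y]
          by linarith
        then show "\<exists>k\<in>C. k (x + y) \<le> i x + j y" using k by blast
      next
        fix i and c :: real and x assume "i \<in> C" "c > 0"
        then show "\<exists>k\<in>C. k (c *\<^sub>R x) \<le> c * i x"
          using sublinear_scale_le[OF CS(1)] by blast
      qed
      moreover have r_le: "r \<le> q" if "q \<in> C" for q
        unfolding r_def by (rule le_funI) (rule cINF_lower[OF bdd that])
      moreover have "r \<le> p"
        using False r_le CS(2) order_trans by blast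
      ultimately show ?thesis by (auto simp: \<S>_def)
    qed
  qed
  then obtain q where "q \<in> \<S>" "\<And>a. a \<in> \<S> \<Longrightarrow> a \<le> q \<Longrightarrow> a = q" by blast
  then show thesis
    using that[of q] order_trans[of _ q p] by (auto simp: \<S>_def)
qed

text \<open>No subspace with prescribed values appears: such a constraint is built into
  \<open>p\<close>, as \<open>tilt norm v\<close> does below.\<close>

theorem Hahn_Banach_sublinear:
  assumes p: "sublinear p"
  obtains f where "linear f" "\<And>x. f x \<le> p x"
proof -
  obtain q where q: "sublinear q" "q \<le> p" and min: "\<And>r. sublinear r \<Longrightarrow> r \<le> q \<Longrightarrow> r = q"
    using ex_minimal_sublinear[OF p] by blast
  have "tilt q y = q" for y
    by (rule min[OF sublinear_tilt[OF q(1)]]) (use tilt_le[OF q(1), of 0] in \<open>simp add: le_fun_def\<close>)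
  then have "q x + q y \<le> q (x + y)" for x y
    using tilt_le[OF q(1), of 1 y x] by simp
  then have add: "q (x + y) = q x + q y" for x y
    using sublinear_add[OF q(1)] by (simp add: order_antisym)
  have minus: "q (- x) = - q x" for x
    using add[of x "- x"] sublinear_zero[OF q(1)] by simp
  have "q (c *\<^sub>R x) = c *\<^sub>R q x" for c x
    using sublinear_scale[OF q(1), of c x] sublinear_scale[OF q(1), of "- c" x] minus[of "c *\<^sub>R x"]
    by (cases "c \<ge> 0") simp_all
  then have "linear q" using add by (intro linearI) auto
  then show thesis using that q(2) by (simp add: le_fun_def)
qed

corollary ex_blinfun_nonzero:
  fixes v :: "'v::real_normed_vector"
  assumes "v \<noteq> 0"
  obtains f :: "'v \<Rightarrow>\<^sub>L real" where "blinfun_apply f v \<noteq> 0"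
proof -
  have n: "sublinear (norm :: 'v \<Rightarrow> real)"
    by (simp add: sublinear_def norm_triangle_ineq)
  obtain f where f: "linear f" "\<And>x. f x \<le> tilt norm v x"
    using Hahn_Banach_sublinear[OF sublinear_tilt[OF n]] by blast
  have le: "f x \<le> norm x" for x
    using f(2)[of x] tilt_le[OF n, of 0 v x] by simp
  have "\<bar>f x\<bar> \<le> norm x" for x
    using le[of x] le[of "- x"] linear_neg[OF f(1), of x] by simp
  then have "bounded_linear f"
    using f(1) by (intro linear_conv_bounded_linear[THEN iffD1] bounded_linear_intro[of f 1])
      (auto simp: linear_add linear_scale)
  \<comment> \<open>At \<open>- v\<close> the term \<open>t = 1\<close> of the tilt is
    \<open>norm 0 - norm v\<close>.\<close>
  moreover have "f (- v) \<le> - norm v"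
    using f(2)[of "- v"] tilt_le[OF n, of 1 v "- v"] by simp
  then have "f v \<noteq> 0"
    using assms linear_neg[OF f(1), of v] by auto
  ultimately show thesis
    using that[of "Blinfun f"] by (simp add: bounded_linear_Blinfun_apply)
qed

lemma blinfun_almost_normed:
  fixes f :: "'v::real_normed_vector \<Rightarrow>\<^sub>L real"
  assumes "e > 0"
  obtains x where "norm x \<le> 1" "norm f - e \<le> blinfun_apply f x"
proof -
  have "\<exists>x. norm x \<le> 1 \<and> norm f - e \<le> blinfun_apply f x"
  proof (rule ccontr)
    assume "\<not> ?thesis"
    then have *: "blinfun_apply f x < norm f - e" if "norm x \<le> 1" for x
      using that by force
    have "norm f \<le> norm f - e"
    proof (rule norm_blinfun_bound)
      show "0 \<le> norm f - e" using *[of 0] by simp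
      fix x
      show "norm (blinfun_apply f x) \<le> (norm f - e) * norm x"
      proof (cases "x = 0")
        case False
        define u where "u = x /\<^sub>R norm x"
        have u: "norm u = 1" and x: "x = norm x *\<^sub>R u" using False by (simp_all add: u_def)
        have "\<bar>blinfun_apply f u\<bar> \<le> norm f - e"
          using *[of u] *[of "- u"] u by (simp add: blinfun.minus_right)
        then have "norm x * \<bar>blinfun_apply f u\<bar> \<le> norm x * (norm f - e)"
          by (rule mult_left_mono) simp
        moreover have "norm (blinfun_apply f x) = norm x * \<bar>blinfun_apply f u\<bar>"
          by (subst x) (simp add: blinfun.scaleR_right abs_mult)
        ultimately show ?thesis by (simp add: mult.commute)
      qed simp
    qed
    then show False using assms by simp
  qed
  then show thesis using that by blast
qed

subsection \<open>Restriction of sequences\<close>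

lemma chi_mult_add: "chi_mult A (x + y) = chi_mult A x + chi_mult A y"
  by (rule bcontfun_eqI) (simp add: apply_chi_mult)

lemma chi_mult_scaleR: "chi_mult A (c *\<^sub>R x) = c *\<^sub>R chi_mult A x"
  by (rule bcontfun_eqI) (simp add: apply_chi_mult)

lemma chi_mult_Un_disjoint:
  "A \<inter> B = {} \<Longrightarrow> chi_mult (A \<union> B) x = chi_mult A x + chi_mult B x"
  by (rule bcontfun_eqI) (auto simp: apply_chi_mult)

lemma norm_chi_mult_le: "norm (chi_mult A x) \<le> norm x"
  by (rule norm_bound) (simp add: apply_chi_mult norm_bounded)

lemma apply_bcontfun_sum:
  "apply_bcontfun (\<Sum>j\<in>J. f j) i = (\<Sum>j\<in>J. apply_bcontfun (f j) i)"
  by (induction J rule: infinite_finite_induct) simp_all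

text \<open>At each coordinate at most one summand is nonzero, so the bound does not grow with the
  number of pieces.\<close>

lemma norm_sum_chi_mult_le:
  assumes disj: "disjoint_family_on A J" and x: "\<And>j. j \<in> J \<Longrightarrow> norm (x j) \<le> b" and "0 \<le> b"
  shows "norm (\<Sum>j\<in>J. chi_mult (A j) (x j)) \<le> b"
proof (rule norm_bound)
  fix i
  have eq: "apply_bcontfun (\<Sum>j\<in>J. chi_mult (A j) (x j)) i
      = (\<Sum>j\<in>J. if i \<in> A j then apply_bcontfun (x j) i else 0)"
    by (simp add: apply_bcontfun_sum apply_chi_mult)
  show "norm (apply_bcontfun (\<Sum>j\<in>J. chi_mult (A j) (x j)) i) \<le> b"
  \<comment> \<open>A sum over an infinite \<open>J\<close> is \<open>0\<close> by convention and is
    treated together with the coordinates outside all \<open>A j\<close>.\<close>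
  proof (cases "finite J \<and> (\<exists>j\<in>J. i \<in> A j)")
    case True
    then obtain j where j: "j \<in> J" "i \<in> A j" by blast
    have "i \<in> A k \<longleftrightarrow> k = j" if "k \<in> J" for k
      using disj j that by (auto simp: disjoint_family_on_def)
    then have "(\<Sum>k\<in>J. if i \<in> A k then apply_bcontfun (x k) i else 0)
        = (\<Sum>k\<in>J. if k = j then apply_bcontfun (x k) i else 0)"
      by (intro sum.cong) auto
    also have "\<dots> = apply_bcontfun (x j) i" using True j by simp
    finally show ?thesis
      using eq x[OF j(1)] norm_bounded[of "x j" i] by simp
  next
    case False
    then have "(\<Sum>k\<in>J. if i \<in> A k then apply_bcontfun (x k) i else 0) = 0"
      by (cases "finite J") (auto intro: sum.neutral)
    then show ?thesis using eq \<open>0 \<le> b\<close> by simp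
  qed
qed

section \<open>Ideals and the subspace \<open>c0_ideal\<close>\<close>

lemma nat_ideal_subset: "nat_ideal \<I> \<Longrightarrow> A \<in> \<I> \<Longrightarrow> B \<subseteq> A \<Longrightarrow> B \<in> \<I>"
  by (simp add: nat_ideal_def)

lemma nat_ideal_Un: "nat_ideal \<I> \<Longrightarrow> A \<in> \<I> \<Longrightarrow> B \<in> \<I> \<Longrightarrow> A \<union> B \<in> \<I>"
  by (simp add: nat_ideal_def)

lemma nat_ideal_finite: "nat_ideal \<I> \<Longrightarrow> finite A \<Longrightarrow> A \<in> \<I>"
  by (simp add: nat_ideal_def)

lemma chi_mult_in_c0_ideal:
  assumes "nat_ideal \<I>" "A \<in> \<I>"
  shows "chi_mult A x \<in> c0_ideal \<I>"
  unfolding c0_ideal_def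
proof (intro CollectI allI impI)
  fix e :: real assume "e > 0"
  then show "{n. e \<le> norm (apply_bcontfun (chi_mult A x) n)} \<in> \<I>"
    by (intro nat_ideal_subset[OF assms]) (auto simp: apply_chi_mult)
qed

lemma subspace_c0_ideal:
  assumes I: "nat_ideal \<I>"
  shows "subspace (c0_ideal \<I>)"
proof (rule subspaceI)
  show "0 \<in> c0_ideal \<I>"
    using I by (simp add: c0_ideal_def nat_ideal_def)
next
  fix x y :: "'a linf" assume x: "x \<in> c0_ideal \<I>" and y: "y \<in> c0_ideal \<I>"
  show "x + y \<in> c0_ideal \<I>"
    unfolding c0_ideal_def
  proof (intro CollectI allI impI)
    fix e :: real assume "e > 0"
    then have "{n. e/2 \<le> norm (apply_bcontfun x n)} \<in> \<I>" "{n. e/2 \<le> norm (apply_bcontfun y n)} \<in> \<I>"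
      using x y half_gt_zero unfolding c0_ideal_def by blast+
    then have U: "{n. e/2 \<le> norm (apply_bcontfun x n)} \<union> {n. e/2 \<le> norm (apply_bcontfun y n)} \<in> \<I>"
      by (rule nat_ideal_Un[OF I])
    show "{n. e \<le> norm (apply_bcontfun (x + y) n)} \<in> \<I>"
    proof (rule nat_ideal_subset[OF I U], rule subsetI)
      fix n assume "n \<in> {n. e \<le> norm (apply_bcontfun (x + y) n)}"
      then have "e \<le> norm (apply_bcontfun x n) + norm (apply_bcontfun y n)"
        using norm_triangle_ineq[of "apply_bcontfun x n" "apply_bcontfun y n"] by simp
      then show "n \<in> {n. e/2 \<le> norm (apply_bcontfun x n)} \<union> {n. e/2 \<le> norm (apply_bcontfun y n)}"
        by simp linarith
    qed
  qed
next
  fix c :: real and x :: "'a linf" assume x: "x \<in> c0_ideal \<I>"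
  show "c *\<^sub>R x \<in> c0_ideal \<I>"
  \<comment> \<open>For \<open>c = 0\<close> the threshold \<open>e / \<bar>c\<bar>\<close> used
    below would be \<open>0\<close>, and its level set all of \<open>nat\<close>.\<close>
  proof (cases "c = 0")
    case True
    then show ?thesis using I by (simp add: c0_ideal_def nat_ideal_def)
  next
    case False
    show ?thesis
      unfolding c0_ideal_def
    proof (intro CollectI allI impI)
      fix e :: real assume "e > 0"
      then have "{n. e / \<bar>c\<bar> \<le> norm (apply_bcontfun x n)} \<in> \<I>"
        using x False unfolding c0_ideal_def by simp
      moreover have "{n. e / \<bar>c\<bar> \<le> norm (apply_bcontfun x n)} = {n. e \<le> norm (apply_bcontfun (c *\<^sub>R x) n)}"
        using False by (simp add: field_simps)
      ultimately show "{n. e \<le> norm (apply_bcontfun (c *\<^sub>R x) n)} \<in> \<I>" by simp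
    qed
  qed
qed

subsection \<open>The dual of a subspace\<close>

lemma dual_on_add: "\<phi> \<in> dual_on V \<Longrightarrow> x \<in> V \<Longrightarrow> y \<in> V \<Longrightarrow> \<phi> (x + y) = \<phi> x + \<phi> y"
  by (simp add: dual_on_def)

lemma dual_on_scaleR: "\<phi> \<in> dual_on V \<Longrightarrow> x \<in> V \<Longrightarrow> \<phi> (c *\<^sub>R x) = c * \<phi> x"
  by (simp add: dual_on_def)

lemma dual_on_zero: "\<phi> \<in> dual_on V \<Longrightarrow> 0 \<in> V \<Longrightarrow> \<phi> 0 = 0"
  using dual_on_scaleR[of \<phi> V 0 0] by simp

text \<open>The constant in \<open>dual_on\<close> may be negative when \<open>V\<close> has no
  nonzero element; its absolute value serves equally well.\<close>

lemma dual_on_bound: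
  assumes "\<phi> \<in> dual_on V"
  obtains K where "K \<ge> 0" "\<And>x. x \<in> V \<Longrightarrow> \<bar>\<phi> x\<bar> \<le> K * norm x"
proof -
  obtain K where K: "\<And>x. x \<in> V \<Longrightarrow> \<bar>\<phi> x\<bar> \<le> K * norm x"
    using assms unfolding dual_on_def by blast
  have "\<bar>\<phi> x\<bar> \<le> \<bar>K\<bar> * norm x" if "x \<in> V" for x
    using K[OF that] mult_right_mono[OF abs_ge_self[of K], of "norm x"] by simp
  then show thesis using that[of "\<bar>K\<bar>"] by simp
qed

lemma dual_on_sum:
  assumes "\<phi> \<in> dual_on V" "subspace V" "\<And>j. j \<in> J \<Longrightarrow> x j \<in> V"
  shows "\<phi> (\<Sum>j\<in>J. x j) = (\<Sum>j\<in>J. \<phi> (x j))"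
  using assms(3)
proof (induction J rule: infinite_finite_induct)
  case (insert j J)
  then have "\<phi> (x j + (\<Sum>j\<in>J. x j)) = \<phi> (x j) + \<phi> (\<Sum>j\<in>J. x j)"
    by (intro dual_on_add[OF assms(1)] subspace_sum[OF assms(2)]) auto
  then show ?case using insert by simp
qed (simp_all add: dual_on_zero[OF assms(1) subspace_0[OF assms(2)]])

lemma dual_on_plus:
  assumes "\<phi> \<in> dual_on V" "\<psi> \<in> dual_on V"
  shows "(\<lambda>x. \<phi> x + \<psi> x) \<in> dual_on V"
proof -
  obtain K where K: "\<And>x. x \<in> V \<Longrightarrow> \<bar>\<phi> x\<bar> \<le> K * norm x" using dual_on_bound[OF assms(1)] by blast
  obtain L where L: "\<And>x. x \<in> V \<Longrightarrow> \<bar>\<psi> x\<bar> \<le> L * norm x" using dual_on_bound[OF assms(2)] by blast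
  have "\<bar>\<phi> x + \<psi> x\<bar> \<le> (K + L) * norm x" if "x \<in> V" for x
    using K[OF that] L[OF that] by (simp add: distrib_right)
  then have "\<exists>K. \<forall>x\<in>V. \<bar>\<phi> x + \<psi> x\<bar> \<le> K * norm x" by blast
  then show ?thesis
    using assms unfolding dual_on_def by (simp add: algebra_simps)
qed

lemma dual_on_cmult:
  assumes "\<phi> \<in> dual_on V"
  shows "(\<lambda>x. c * \<phi> x) \<in> dual_on V"
proof -
  obtain K where K: "\<And>x. x \<in> V \<Longrightarrow> \<bar>\<phi> x\<bar> \<le> K * norm x" using dual_on_bound[OF assms] by blast
  have "\<bar>c * \<phi> x\<bar> \<le> (\<bar>c\<bar> * K) * norm x" if "x \<in> V" for x
    using mult_left_mono[OF K[OF that], of "\<bar>c\<bar>"] by (simp add: abs_mult mult.assoc)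
  then have "\<exists>K. \<forall>x\<in>V. \<bar>c * \<phi> x\<bar> \<le> K * norm x" by blast
  then show ?thesis
    using assms unfolding dual_on_def by (simp add: algebra_simps)
qed

lemma dual_norm_upper:
  assumes "\<phi> \<in> dual_on V" "x \<in> V" "norm x \<le> 1"
  shows "\<bar>\<phi> x\<bar> \<le> dual_norm V \<phi>"
proof -
  obtain K where K: "K \<ge> 0" "\<And>x. x \<in> V \<Longrightarrow> \<bar>\<phi> x\<bar> \<le> K * norm x"
    using dual_on_bound[OF assms(1)] by blast
  \<comment> \<open>A supremum of reals dominates its members only when the set is bounded
    above.\<close>
  have "bdd_above ((\<lambda>x. \<bar>\<phi> x\<bar>) ` {x \<in> V. norm x \<le> 1})"
  proof (rule bdd_aboveI2)
    fix x assume "x \<in> {x \<in> V. norm x \<le> 1}"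
    then show "\<bar>\<phi> x\<bar> \<le> K"
      using K(2)[of x] mult_left_mono[of "norm x" 1 K] K(1) by simp
  qed
  then show ?thesis
    unfolding dual_norm_def using assms by (intro cSUP_upper) auto
qed

lemma dual_norm_least:
  assumes "0 \<in> V" "\<And>x. x \<in> V \<Longrightarrow> norm x \<le> 1 \<Longrightarrow> \<bar>\<phi> x\<bar> \<le> b"
  shows "dual_norm V \<phi> \<le> b"
  unfolding dual_norm_def using assms by (intro cSUP_least) auto

subsection \<open>The representing measure\<close>

text \<open>Discharges the side condition of \<open>Blinfun\<close>: a bound \<open>K\<close> for
  \<open>\<phi>\<close> also works here, since restriction does not increase the norm.\<close>

lemma rep_measure_apply:
  assumes I: "nat_ideal \<I>" and phi: "\<phi> \<in> dual_on (c0_ideal \<I>)" and A: "A \<in> \<I>"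
  shows "blinfun_apply (rep_measure \<I> \<phi> A) x = \<phi> (chi_mult A x)"
proof -
  obtain K where K: "K \<ge> 0" "\<And>x. x \<in> c0_ideal \<I> \<Longrightarrow> \<bar>\<phi> x\<bar> \<le> K * norm x"
    using dual_on_bound[OF phi] by blast
  note mem = chi_mult_in_c0_ideal[OF I A]
  have "bounded_linear (\<lambda>x. \<phi> (chi_mult A x))"
  proof (rule bounded_linear_intro[where K = K])
    fix x y c
    show "\<phi> (chi_mult A (x + y)) = \<phi> (chi_mult A x) + \<phi> (chi_mult A y)"
      by (simp add: chi_mult_add dual_on_add[OF phi] mem)
    show "\<phi> (chi_mult A (c *\<^sub>R x)) = c *\<^sub>R \<phi> (chi_mult A x)"
      by (simp add: chi_mult_scaleR dual_on_scaleR[OF phi] mem)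
    show "norm (\<phi> (chi_mult A x)) \<le> norm x * K"
      using K(2)[OF mem, of x] mult_left_mono[OF norm_chi_mult_le[of A x] K(1)]
      by (simp add: mult.commute)
  qed
  then show ?thesis
    using A by (simp add: rep_measure_def bounded_linear_Blinfun_apply)
qed

lemma rep_measure_Un_disjoint:
  assumes "nat_ideal \<I>" "\<phi> \<in> dual_on (c0_ideal \<I>)" "A \<in> \<I>" "B \<in> \<I>" "A \<inter> B = {}"
  shows "rep_measure \<I> \<phi> (A \<union> B) = rep_measure \<I> \<phi> A + rep_measure \<I> \<phi> B"
  using assms
  by (intro blinfun_eqI)
    (simp add: rep_measure_apply nat_ideal_Un blinfun.add_left chi_mult_Un_disjoint
      dual_on_add chi_mult_in_c0_ideal)

lemma sum_norm_rep_measure_le: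
  fixes \<phi> :: "'a::real_normed_vector linf \<Rightarrow> real"
  assumes I: "nat_ideal \<I>" and phi: "\<phi> \<in> dual_on (c0_ideal \<I>)"
    and A: "\<And>j. j < (n::nat) \<Longrightarrow> A j \<in> \<I>" "disjoint_family_on A {..<n}"
  shows "(\<Sum>j<n. norm (rep_measure \<I> \<phi> (A j))) \<le> dual_norm (c0_ideal \<I>) \<phi>"
proof (rule field_le_epsilon)
  fix e :: real assume e: "e > 0"
  \<comment> \<open>Each of the \<open>n\<close> choices may lose \<open>d\<close>; the added
    \<open>1\<close> covers \<open>n = 0\<close>.\<close>
  define d where "d = e / (real n + 1)"
  have d: "d > 0" "real n * d \<le> e" using e by (simp_all add: d_def field_simps)
  have "\<exists>x. norm x \<le> 1 \<and> norm (rep_measure \<I> \<phi> (A j)) - d \<le> blinfun_apply (rep_measure \<I> \<phi> (A j)) x" for j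
    using blinfun_almost_normed[OF d(1), of "rep_measure \<I> \<phi> (A j)"] by blast
  then obtain x where x: "\<And>j. norm (x j) \<le> 1"
    "\<And>j. norm (rep_measure \<I> \<phi> (A j)) - d \<le> blinfun_apply (rep_measure \<I> \<phi> (A j)) (x j)"
    by metis
  define z where "z = (\<Sum>j<n. chi_mult (A j) (x j))"
  have mem: "chi_mult (A j) (x j) \<in> c0_ideal \<I>" if "j \<in> {..<n}" for j
    using chi_mult_in_c0_ideal[OF I A(1)] that by simp
  have "(\<Sum>j<n. norm (rep_measure \<I> \<phi> (A j))) - real n * d
      = (\<Sum>j<n. norm (rep_measure \<I> \<phi> (A j)) - d)"
    by (simp add: sum_subtractf)
  also have "\<dots> \<le> (\<Sum>j<n. \<phi> (chi_mult (A j) (x j)))"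
    by (rule sum_mono) (simp add: x(2) A(1) flip: rep_measure_apply[OF I phi])
  also have "\<dots> = \<phi> z"
    unfolding z_def by (rule dual_on_sum[OF phi subspace_c0_ideal[OF I] mem, symmetric])
  also have "\<dots> \<le> dual_norm (c0_ideal \<I>) \<phi>"
  proof -
    have "z \<in> c0_ideal \<I>"
      unfolding z_def by (rule subspace_sum[OF subspace_c0_ideal[OF I] mem])
    moreover have "norm z \<le> 1"
      unfolding z_def by (rule norm_sum_chi_mult_le[OF A(2) x(1)]) simp
    ultimately show ?thesis using dual_norm_upper[OF phi, of z] by simp
  qed
  finally show "(\<Sum>j<n. norm (rep_measure \<I> \<phi> (A j))) \<le> dual_norm (c0_ideal \<I>) \<phi> + e"
    using d(2) by linarith
qed

lemma total_variation_leI: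
  assumes "\<And>(n::nat) A. (\<And>j. j < n \<Longrightarrow> A j \<in> \<I>) \<Longrightarrow> disjoint_family_on A {..<n}
    \<Longrightarrow> (\<Sum>j<n. norm (m (A j))) \<le> b"
  shows "total_variation \<I> m \<le> ennreal b"
  unfolding total_variation_def
proof (rule SUP_least, clarify)
  fix n :: nat and A assume "\<forall>j<n. A j \<in> \<I>" "disjoint_family_on A {..<n}"
  then show "(\<Sum>j<n. ennreal (norm (m (A j)))) \<le> ennreal b"
    using assms[of n A] by (simp add: sum_ennreal ennreal_leI)
qed

lemma norm_le_total_variation:
  assumes "A \<in> \<I>"
  shows "ennreal (norm (m A)) \<le> total_variation \<I> m"
  unfolding total_variation_def
  \<comment> \<open>The family consisting of the single set \<open>A\<close>.\<close>
  by (rule SUP_upper2[where i = "(1, \<lambda>_. A)"])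
    (use assms in \<open>auto simp: disjoint_family_on_def\<close>)

text \<open>The real number \<open>t\<close> keeps the estimate out of \<open>ennreal\<close>; that
  the variation is finite comes from the opposite inequality.\<close>

lemma dual_norm_le_total_variation:
  fixes \<phi> :: "'a::real_normed_vector linf \<Rightarrow> real"
  assumes I: "nat_ideal \<I>" and phi: "\<phi> \<in> dual_on (c0_ideal \<I>)"
    and tv: "total_variation \<I> (rep_measure \<I> \<phi>) = ennreal t" "t \<ge> 0"
  shows "dual_norm (c0_ideal \<I>) \<phi> \<le> t"
proof (rule dual_norm_least)
  show "0 \<in> c0_ideal \<I>" using subspace_0[OF subspace_c0_ideal[OF I]] .
  fix x :: "'a linf" assume x: "x \<in> c0_ideal \<I>" and nx: "norm x \<le> 1"
  obtain K where K: "K \<ge> 0" "\<And>x. x \<in> c0_ideal \<I> \<Longrightarrow> \<bar>\<phi> x\<bar> \<le> K * norm x"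
    using dual_on_bound[OF phi] by blast
  show "\<bar>\<phi> x\<bar> \<le> t"
  proof (rule field_le_epsilon)
    fix e :: real assume e: "e > 0"
    define d where "d = e / (K + 1)"
    have d: "d > 0" "K * d \<le> e" using e K(1) by (simp_all add: d_def field_simps)
    define A where "A = {n. d \<le> norm (apply_bcontfun x n)}"
    have A: "A \<in> \<I>" using x d(1) by (simp add: A_def c0_ideal_def)
    let ?y = "chi_mult A x"
    have y: "?y \<in> c0_ideal \<I>" by (rule chi_mult_in_c0_ideal[OF I A])
    have xy: "x - ?y \<in> c0_ideal \<I>" by (rule subspace_diff[OF subspace_c0_ideal[OF I] x y])
    \<comment> \<open>The difference vanishes on \<open>A\<close> and agrees with \<open>x\<close>
      off \<open>A\<close>, where the norms are below \<open>d\<close>.\<close>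
    have "norm (x - ?y) \<le> d"
      by (rule norm_bound) (use d(1) in \<open>auto simp: apply_chi_mult A_def\<close>)
    then have "\<bar>\<phi> (x - ?y)\<bar> \<le> e"
      using K(2)[OF xy] mult_left_mono[of "norm (x - ?y)" d K] K(1) d(2) by linarith
    moreover have "\<phi> x = \<phi> ?y + \<phi> (x - ?y)"
      using dual_on_add[OF phi y xy] by simp
    moreover have "\<bar>\<phi> ?y\<bar> \<le> norm (rep_measure \<I> \<phi> A) * norm x"
      using norm_blinfun[of "rep_measure \<I> \<phi> A" x] by (simp add: rep_measure_apply[OF I phi A])
    moreover have "norm (rep_measure \<I> \<phi> A) * norm x \<le> norm (rep_measure \<I> \<phi> A)"
      using mult_left_mono[OF nx, of "norm (rep_measure \<I> \<phi> A)"] by simp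
    moreover have "norm (rep_measure \<I> \<phi> A) \<le> t"
      using norm_le_total_variation[OF A, of "rep_measure \<I> \<phi>"] tv by (simp add: ennreal_le_iff)
    ultimately show "\<bar>\<phi> x\<bar> \<le> t + e" by linarith
  qed
qed

lemma total_variation_rep_measure:
  fixes \<phi> :: "'a::real_normed_vector linf \<Rightarrow> real"
  assumes I: "nat_ideal \<I>" and phi: "\<phi> \<in> dual_on (c0_ideal \<I>)"
  shows "total_variation \<I> (rep_measure \<I> \<phi>) = ennreal (dual_norm (c0_ideal \<I>) \<phi>)"
proof -
  have le: "total_variation \<I> (rep_measure \<I> \<phi>) \<le> ennreal (dual_norm (c0_ideal \<I>) \<phi>)"
    by (rule total_variation_leI) (rule sum_norm_rep_measure_le[OF I phi])
  \<comment> \<open>The first inequality rules out the value infinity.\<close>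
  then obtain t where t: "t \<ge> 0" "total_variation \<I> (rep_measure \<I> \<phi>) = ennreal t"
    by (cases "total_variation \<I> (rep_measure \<I> \<phi>)") (auto simp: top_unique)
  then show ?thesis
    using le dual_norm_le_total_variation[OF I phi t(2,1)] by (intro antisym) (auto intro: ennreal_leI)
qed

lemma dual_norm_nonneg:
  assumes "nat_ideal \<I>" "\<phi> \<in> dual_on (c0_ideal \<I>)"
  shows "0 \<le> dual_norm (c0_ideal \<I>) \<phi>"
  using dual_norm_upper[OF assms(2) subspace_0[OF subspace_c0_ideal[OF assms(1)]]] by fastforce

lemma rep_measure_in_ba:
  assumes "nat_ideal \<I>" "\<phi> \<in> dual_on (c0_ideal \<I>)"
  shows "rep_measure \<I> \<phi> \<in> ba \<I>"
  unfolding ba_def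
  using rep_measure_Un_disjoint[OF assms] total_variation_rep_measure[OF assms]
  by (auto simp: rep_measure_def[of \<I> \<phi> A for A])

subsection \<open>Measures that are not represented\<close>

text \<open>Among disjoint sets at most one contains \<open>k\<close>, so every variation sum is at
  most \<open>norm g\<close>.\<close>

lemma point_mass_in_ba:
  assumes I: "nat_ideal \<I>"
  shows "(\<lambda>A. if A \<in> \<I> \<and> k \<in> A then g else 0) \<in> ba \<I>" (is "?m \<in> _")
proof -
  have "(\<Sum>j<n. norm (?m (A j))) \<le> norm g" if "disjoint_family_on A {..<n}" for n :: nat and A
  proof (cases "\<exists>j<n. k \<in> A j")
    case True
    then obtain j where j: "j < n" "k \<in> A j" by blast
    have "k \<notin> A i" if "i < n" "i \<noteq> j" for i
      using \<open>disjoint_family_on A {..<n}\<close> j that by (auto simp: disjoint_family_on_def)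
    then have "(\<Sum>i<n. norm (?m (A i))) \<le> (\<Sum>i<n. if i = j then norm g else 0)"
      by (intro sum_mono) auto
    then show ?thesis using j by simp
  next
    case False
    then have "(\<Sum>j<n. norm (?m (A j))) = 0" by (intro sum.neutral) auto
    then show ?thesis by simp
  qed
  then have "total_variation \<I> ?m \<le> ennreal (norm g)"
    by (intro total_variation_leI)
  then have "total_variation \<I> ?m < \<infinity>"
    using ennreal_less_top[of "norm g"] by (simp add: order_le_less_trans)
  then show ?thesis
    unfolding ba_def using nat_ideal_Un[OF I] by auto
qed

lemma rep_measure_not_onto_ba:
  assumes I: "nat_ideal \<I>" and "(v::'a::real_normed_vector) \<noteq> 0"
  shows "rep_measure \<I> ` dual_on (c0_ideal \<I> :: 'a linf set) \<noteq> ba \<I>"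
proof
  assume onto: "rep_measure \<I> ` dual_on (c0_ideal \<I> :: 'a linf set) = ba \<I>"
  \<comment> \<open>The sequence with \<open>v\<close> at coordinate \<open>1\<close> and
    \<open>0\<close> elsewhere: restriction to \<open>{0}\<close> kills it, although
    \<open>g\<close> does not.\<close>
  define w where "w = chi_mult {1} (const_bcontfun v)"
  have "apply_bcontfun w 1 = v" by (simp add: w_def apply_chi_mult)
  then have "w \<noteq> 0" using assms(2) by auto
  then obtain g :: "'a linf \<Rightarrow>\<^sub>L real" where g: "blinfun_apply g w \<noteq> 0"
    using ex_blinfun_nonzero by blast
  obtain \<phi> :: "'a linf \<Rightarrow> real" where phi: "\<phi> \<in> dual_on (c0_ideal \<I>)"
    and eq: "rep_measure \<I> \<phi> = (\<lambda>A. if A \<in> \<I> \<and> 0 \<in> A then g else 0)"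
    using point_mass_in_ba[OF I, of 0 g] unfolding onto[symmetric] by force
  have 0: "{0} \<in> \<I>" using nat_ideal_finite[OF I] by simp
  have "blinfun_apply g w = \<phi> (chi_mult {0} w)"
    using rep_measure_apply[OF I phi 0, of w] 0 by (simp add: eq)
  also have "chi_mult {0} w = 0"
    by (rule bcontfun_eqI) (simp add: w_def apply_chi_mult)
  finally show False
    using g dual_on_zero[OF phi subspace_0[OF subspace_c0_ideal[OF I]]] by simp
qed

text \<open>Linearity and equality of norms together express the isometry. For the zero space both
  sides are trivial and the operator is onto, hence the premise of the last conjunct.\<close>

theorem theorem3p3:
  fixes \<I> :: "nat set set"
  assumes "nat_ideal \<I>"
  shows "(\<forall>\<phi>\<in>dual_on (c0_ideal \<I> :: 'a::banach linf set). \<forall>A\<in>\<I>. \<forall>x.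
            blinfun_apply (rep_measure \<I> \<phi> A) x = \<phi> (chi_mult A x)) \<and>
         rep_measure \<I> ` dual_on (c0_ideal \<I> :: 'a linf set) \<subseteq> ba \<I> \<and>
         (\<forall>\<phi>\<in>dual_on (c0_ideal \<I> :: 'a linf set). \<forall>\<psi>\<in>dual_on (c0_ideal \<I>).
            rep_measure \<I> (\<lambda>x. \<phi> x + \<psi> x) = (\<lambda>A. rep_measure \<I> \<phi> A + rep_measure \<I> \<psi> A)) \<and>
         (\<forall>c. \<forall>\<phi>\<in>dual_on (c0_ideal \<I> :: 'a linf set).
            rep_measure \<I> (\<lambda>x. c * \<phi> x) = (\<lambda>A. c *\<^sub>R rep_measure \<I> \<phi> A)) \<and>
         (\<forall>\<phi>\<in>dual_on (c0_ideal \<I> :: 'a linf set).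
            ba_norm \<I> (rep_measure \<I> \<phi>) = dual_norm (c0_ideal \<I>) \<phi>) \<and>
         ((\<exists>x::'a. x \<noteq> 0) \<longrightarrow>
            rep_measure \<I> ` dual_on (c0_ideal \<I> :: 'a linf set) \<noteq> ba \<I>)"
proof (intro conjI ballI allI impI)
  fix \<phi> :: "'a linf \<Rightarrow> real" and A x assume "\<phi> \<in> dual_on (c0_ideal \<I>)" "A \<in> \<I>"
  then show "blinfun_apply (rep_measure \<I> \<phi> A) x = \<phi> (chi_mult A x)"
    by (rule rep_measure_apply[OF assms])
next
  show "rep_measure \<I> ` dual_on (c0_ideal \<I> :: 'a linf set) \<subseteq> ba \<I>"
    using rep_measure_in_ba[OF assms] by blast
next
  fix \<phi> \<psi> :: "'a linf \<Rightarrow> real"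
  assume phi: "\<phi> \<in> dual_on (c0_ideal \<I>)" and psi: "\<psi> \<in> dual_on (c0_ideal \<I>)"
  \<comment> \<open>The sum lies in the dual again, so all three values of \<open>Blinfun\<close>
    can be evaluated and compared pointwise.\<close>
  show "rep_measure \<I> (\<lambda>x. \<phi> x + \<psi> x) = (\<lambda>A. rep_measure \<I> \<phi> A + rep_measure \<I> \<psi> A)"
  proof
    fix A
    show "rep_measure \<I> (\<lambda>x. \<phi> x + \<psi> x) A = rep_measure \<I> \<phi> A + rep_measure \<I> \<psi> A"
    proof (cases "A \<in> \<I>")
      case True
      then show ?thesis
        by (intro blinfun_eqI) (simp add: blinfun.add_left
          rep_measure_apply[OF assms dual_on_plus[OF phi psi]]
          rep_measure_apply[OF assms phi] rep_measure_apply[OF assms psi])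
    qed (simp add: rep_measure_def)
  qed
next
  fix c and \<phi> :: "'a linf \<Rightarrow> real"
  assume phi: "\<phi> \<in> dual_on (c0_ideal \<I>)"
  show "rep_measure \<I> (\<lambda>x. c * \<phi> x) = (\<lambda>A. c *\<^sub>R rep_measure \<I> \<phi> A)"
  proof
    fix A
    show "rep_measure \<I> (\<lambda>x. c * \<phi> x) A = c *\<^sub>R rep_measure \<I> \<phi> A"
    proof (cases "A \<in> \<I>")
      case True
      then show ?thesis
        by (intro blinfun_eqI) (simp add: blinfun.scaleR_left
          rep_measure_apply[OF assms dual_on_cmult[OF phi]] rep_measure_apply[OF assms phi])
    qed (simp add: rep_measure_def)
  qed
next
  fix \<phi> :: "'a linf \<Rightarrow> real"
  assume phi: "\<phi> \<in> dual_on (c0_ideal \<I>)"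
  show "ba_norm \<I> (rep_measure \<I> \<phi>) = dual_norm (c0_ideal \<I>) \<phi>"
    by (simp add: ba_norm_def total_variation_rep_measure[OF assms phi]
      dual_norm_nonneg[OF assms phi])
next
  assume "\<exists>x::'a. x \<noteq> 0"
  then show "rep_measure \<I> ` dual_on (c0_ideal \<I> :: 'a linf set) \<noteq> ba \<I>"
    using rep_measure_not_onto_ba[OF assms] by blast
qed

end
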